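(* Let $\mathbb{F}_q$ be a finite field and $f \in \mathbb{F}_q[t]$. The following are equivalent: (a) $f$ is a WSC polynomial. (b) $f$ is weakly WSC, and for all $y \in f(\mathbb{F}_q)$ we have $e(y) \varphi'(y) = C(f)$, where $C(f) := \sum_{x \in \mathbb{F}_q} f(x)^{u(f)}$, and $C(f)\in \mathbb{F}_q^{\times}$. (c) There is $C \in \mathbb{F}_q^{\times}$ such that $e(y) \varphi'(y) = C$ for all $y \in f(\mathbb{F}_q)$.
   Context: For $f \in \mathbb{F}_q[t]$, $u(f)$ denotes the least positive integer $\delta$ such that $\sum_{x \in \mathbb{F}_q} f(x)^{\delta} \neq 0$ if such $\delta$ exists, and $u(f)=\infty$ otherwise. $f$ is weakly WSC if $u(f)<\infty$, and WSC if $u(f)=\# f(\mathbb{F}_q)-1$, where $f(\mathbb{F}_q)=\{f(x)\mid x\in\mathbb{F}_q\}$ is the value set. For $y\in f(\mathbb{F}_q)$, $e(y)=\#\{x\in\mathbb{F}_q\mid f(x)=y\}$ (viewed as an element of $\mathbb{F}_q$ in the products), and $\varphi(t)=\prod_{y\in f(\mathbb{F}_q)}(t-y)$, with $\varphi'$ its formal derivative. *)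

theory Defs
  imports "HOL-Computational_Algebra.Polynomial" "HOL-Library.Extended_Nat"
begin

definition power_sum :: "'a::{field,finite} poly \<Rightarrow> nat \<Rightarrow> 'a" where
  "power_sum f d = (\<Sum>x\<in>UNIV. poly f x ^ d)"

definition u :: "'a::{field,finite} poly \<Rightarrow> enat" where
  "u f = (if \<exists>d>0. power_sum f d \<noteq> 0
          then enat (LEAST d. d > 0 \<and> power_sum f d \<noteq> 0) else \<infinity>)"

definition value_set :: "'a::{field,finite} poly \<Rightarrow> 'a set" where
  "value_set f = range (poly f)"

definition weakly_WSC :: "'a::{field,finite} poly \<Rightarrow> bool" where
  "weakly_WSC f \<longleftrightarrow> u f < \<infinity>"

text \<open>The natural-number subtraction is not truncated: the value set is finite and nonempty.\<close>

definition WSC :: "'a::{field,finite} poly \<Rightarrow> bool" where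
  "WSC f \<longleftrightarrow> u f = enat (card (value_set f) - 1)"

definition e :: "'a::{field,finite} poly \<Rightarrow> 'a \<Rightarrow> nat" where
  "e f y = card {x. poly f x = y}"

definition phi :: "'a::{field,finite} poly \<Rightarrow> 'a poly" where
  "phi f = (\<Prod>y\<in>value_set f. [:- y, 1:])"

text \<open>Only meaningful for weakly WSC polynomials, where \<open>u f\<close> is finite.\<close>

definition C :: "'a::{field,finite} poly \<Rightarrow> 'a" where
  "C f = power_sum f (the_enat (u f))"

end

theory Submission imports Defs begin

text \<open>
  Let \<open>n\<close> be the size of the value set \<open>V\<close> and \<open>L(p) = \<Sum>x. p(f(x)) = \<Sum>y\<in>V. e(y) p(y)\<close>, a linear
  functional on polynomials. As \<open>L(1) = q = 0\<close>, being WSC means that on polynomials of degree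
  below \<open>n\<close>, \<open>L\<close> is a nonzero multiple \<open>c\<close> of the coefficient of \<open>t ^ (n - 1)\<close>. The monic
  polynomials \<open>\<phi>(t) / (t - y)\<close> form a basis of this space, and \<open>L\<close> takes the value \<open>e(y) \<phi>'(y)\<close>
  on them.
\<close>

text \<open>Translation by 1 permutes the ring, so adding 1 to each of its elements leaves their sum
  unchanged.\<close>

lemma of_nat_card_UNIV_eq_0: "of_nat (card (UNIV :: 'a set)) = (0 :: 'a::{ring_1,finite})"
proof -
  have "(\<Sum>x\<in>UNIV. x + 1) = (\<Sum>x\<in>UNIV. x :: 'a)"
    by (rule sum.reindex_bij_witness[where i = "\<lambda>x. x - 1" and j = "\<lambda>x. x + 1"]) auto
  then show ?thesis
    by (simp add: sum.distrib)
qed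

text \<open>By the product rule, only the term that differentiates the factor vanishing at
  \<open>y\<close> survives there.\<close>

lemma pderiv_prod_linear_eq_prod_diff:
  fixes A :: "'a::idom set"
  assumes "finite A" "y \<in> A"
  shows "poly (pderiv (\<Prod>a\<in>A. [:- a, 1:])) y = (\<Prod>a\<in>A - {y}. y - a)"
proof -
  have "(\<Prod>a\<in>A. [:- a, 1:]) = [:- y, 1:] * (\<Prod>a\<in>A - {y}. [:- a, 1:])"
    using assms by (simp add: prod.remove)
  then show ?thesis
    by (simp add: pderiv_mult pderiv_pCons poly_prod del: mult_pCons_left)
qed

text \<open>Lagrange interpolation at the nodes \<open>A\<close>, read off at the top coefficient:
  every basis numerator \<open>b y\<close> is monic of degree \<open>card A - 1\<close>.\<close>

lemma coeff_eq_sum_lagrange: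
  fixes A :: "'a::field set" and p :: "'a poly"
  assumes "finite A" "degree p < card A"
  shows "coeff p (card A - 1) = (\<Sum>y\<in>A. poly p y / (\<Prod>a\<in>A - {y}. y - a))"
proof -
  define b where "b y = (\<Prod>a\<in>A - {y}. [:- a, 1:])" for y
  define w where "w y = poly p y / (\<Prod>a\<in>A - {y}. y - a)" for y
  have deg: "degree (b y) = card A - 1" if "y \<in> A" for y
    using that assms by (simp add: b_def degree_prod_sum_eq)
  have monic: "coeff (b y) (card A - 1) = 1" if "y \<in> A" for y
    using lead_coeff_prod[of "\<lambda>a. [:- a, 1:]" "A - {y}"] deg[OF that] by (simp add: b_def)
  have "p = (\<Sum>y\<in>A. smult (w y) (b y))"
  \<comment> \<open>Both sides have degree below \<open>card A\<close>, so agreement at the nodes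
    suffices.\<close>
  proof (rule poly_eqI_degree[where A = A])
    fix z assume z: "z \<in> A"
    have "poly (b y) z = 0" if "y \<in> A - {z}" for y
      using z that assms by (auto simp: b_def poly_prod)
    then have "poly (\<Sum>y\<in>A. smult (w y) (b y)) z = w z * poly (b z) z"
      using z assms by (simp add: poly_sum sum.remove)
    also have "\<dots> = poly p z"
      using assms by (auto simp: w_def b_def poly_prod)
    finally show "poly p z = poly (\<Sum>y\<in>A. smult (w y) (b y)) z" ..
  next
    have "degree (\<Sum>y\<in>A. smult (w y) (b y)) \<le> card A - 1"
      using assms deg by (intro degree_sum_le) auto
    then show "degree (\<Sum>y\<in>A. smult (w y) (b y)) < card A"
      using assms by linarith
  qed (use assms in auto)
  then have "coeff p (card A - 1) = (\<Sum>y\<in>A. w y * coeff (b y) (card A - 1))"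
    by (metis (no_types, lifting) coeff_smult coeff_sum sum.cong)
  then show ?thesis
    using monic by (simp add: w_def)
qed

lemma sum_poly_eq_sum_value_set:
  fixes f :: "'a::{field,finite} poly" and g :: "'a \<Rightarrow> 'a"
  shows "(\<Sum>x\<in>UNIV. g (poly f x)) = (\<Sum>y\<in>value_set f. of_nat (e f y) * g y)"
proof -
  have "(\<Sum>x\<in>UNIV. g (poly f x)) = (\<Sum>y\<in>value_set f. \<Sum>x\<in>{x\<in>UNIV. poly f x = y}. g (poly f x))"
    unfolding value_set_def by (rule sum.image_gen) simp
  also have "\<dots> = (\<Sum>y\<in>value_set f. of_nat (e f y) * g y)"
    by (rule sum.cong) (auto simp: e_def)
  finally show ?thesis .
qed

lemma power_sum_0 [simp]: "power_sum f 0 = 0"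
  by (simp add: power_sum_def of_nat_card_UNIV_eq_0)

text \<open>The exponent 0 may join the vanishing range because \<open>power_sum f 0 = 0\<close>;
  the same fact forces \<open>k > 0\<close>.\<close>

lemma u_eq_enat_iff:
  "u f = enat k \<longleftrightarrow> power_sum f k \<noteq> 0 \<and> (\<forall>d<k. power_sum f d = 0)"
proof
  assume u: "u f = enat k"
  then have ex: "\<exists>d>0. power_sum f d \<noteq> 0"
    and k: "k = (LEAST d. d > 0 \<and> power_sum f d \<noteq> 0)"
    by (auto simp: u_def split: if_splits)
  have "power_sum f k \<noteq> 0"
    using LeastI_ex[OF ex] k by blast
  moreover have "power_sum f d = 0" if "d < k" for d
    using not_less_Least[of d "\<lambda>d. d > 0 \<and> power_sum f d \<noteq> 0"] that k
    by (cases "d = 0") auto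
  ultimately show "power_sum f k \<noteq> 0 \<and> (\<forall>d<k. power_sum f d = 0)"
    by blast
next
  assume *: "power_sum f k \<noteq> 0 \<and> (\<forall>d<k. power_sum f d = 0)"
  then have "k > 0"
    by (cases k) auto
  moreover have "(LEAST d. d > 0 \<and> power_sum f d \<noteq> 0) = k"
    using * \<open>k > 0\<close> by (intro Least_equality) (auto simp: not_less[symmetric])
  ultimately show "u f = enat k"
    using * by (auto simp: u_def)
qed

lemma card_value_set_pos: "card (value_set f) > 0"
  by (simp add: value_set_def card_gt_0_iff)

lemma WSC_iff:
  "WSC f \<longleftrightarrow> power_sum f (card (value_set f) - 1) \<noteq> 0 \<and>
    (\<forall>d < card (value_set f) - 1. power_sum f d = 0)"
  by (simp add: WSC_def u_eq_enat_iff)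

lemma WSC_imp_mult_pderiv_eq_C:
  assumes "WSC f" "y \<in> value_set f"
  shows "of_nat (e f y) * poly (pderiv (phi f)) y = C f"
proof -
  define V n where "V = value_set f" and "n = card V - 1"
  define p where "p = (\<Prod>a\<in>V - {y}. [:- a, 1:])"
  have y: "y \<in> V" using assms by (simp add: V_def)
  have deg: "degree p = n"
    using y by (simp add: p_def n_def degree_prod_sum_eq)
  have monic: "coeff p n = 1"
    using lead_coeff_prod[of "\<lambda>a. [:- a, 1:]" "V - {y}"] deg by (simp add: p_def)
  have C: "C f = power_sum f n"
    using assms by (simp add: C_def WSC_def n_def V_def)
  \<comment> \<open>The sum is computed twice: by powers of \<open>f\<close>, where WSC leaves only
    the leading term of \<open>p\<close>, and by fibres of \<open>f\<close>, where \<open>p\<close>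
    vanishes at every value except \<open>y\<close>.\<close>
  have "(\<Sum>x\<in>UNIV. poly p (poly f x)) = (\<Sum>d\<le>n. coeff p d * power_sum f d)"
    unfolding power_sum_def poly_altdef deg sum_distrib_left by (rule sum.swap)
  also have "\<dots> = (\<Sum>d\<in>{n}. coeff p d * power_sum f d)"
    using assms by (intro sum.mono_neutral_right) (auto simp: WSC_iff n_def V_def)
  also have "\<dots> = C f"
    by (simp add: monic C)
  finally have "C f = (\<Sum>z\<in>V. of_nat (e f z) * poly p z)"
    by (simp add: sum_poly_eq_sum_value_set V_def)
  also have "\<dots> = (\<Sum>z\<in>{y}. of_nat (e f z) * poly p z)"
    using y by (intro sum.mono_neutral_right) (auto simp: p_def poly_prod)
  also have "\<dots> = of_nat (e f y) * poly (pderiv (phi f)) y"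
    using y by (simp add: p_def phi_def poly_prod pderiv_prod_linear_eq_prod_diff V_def)
  finally show ?thesis ..
qed

text \<open>The hypothesis makes the multiplicities \<open>c\<close> times the Lagrange weights of
  the value set, so each low power sum is \<open>c\<close> times the top coefficient of a
  monomial.\<close>

lemma WSC_if_mult_pderiv_const:
  assumes "c \<noteq> 0"
    and c: "\<And>y. y \<in> value_set f \<Longrightarrow> of_nat (e f y) * poly (pderiv (phi f)) y = c"
  shows "WSC f"
proof -
  define V where "V = value_set f"
  \<comment> \<open>Division is legitimate: the product is \<open>phi'(y)\<close>, and all its
    factors are nonzero.\<close>
  have e: "of_nat (e f y) = c / (\<Prod>a\<in>V - {y}. y - a)" if "y \<in> V" for y
    using c[of y] that
    by (auto simp: V_def phi_def pderiv_prod_linear_eq_prod_diff field_simps)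
  have "power_sum f d = (if d = card V - 1 then c else 0)" if "d < card V" for d
  proof -
    have "power_sum f d = (\<Sum>y\<in>V. of_nat (e f y) * y ^ d)"
      by (simp add: power_sum_def V_def sum_poly_eq_sum_value_set[of "\<lambda>y. y ^ d"])
    also have "\<dots> = c * (\<Sum>y\<in>V. poly (monom 1 d) y / (\<Prod>a\<in>V - {y}. y - a))"
      by (simp add: e poly_monom sum_distrib_left)
    also have "\<dots> = c * coeff (monom 1 d) (card V - 1)"
      using that by (subst coeff_eq_sum_lagrange) (auto simp: degree_monom_eq)
    finally show ?thesis
      by simp
  qed
  then show ?thesis
    using \<open>c \<noteq> 0\<close> card_value_set_pos[of f] by (auto simp: WSC_iff V_def)
qed

theorem theorem2p1:
  fixes f :: "'a::{field,finite} poly"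
  shows "(WSC f \<longleftrightarrow>
            weakly_WSC f \<and>
            (\<forall>y\<in>value_set f. of_nat (e f y) * poly (pderiv (phi f)) y = C f) \<and>
            C f \<noteq> 0)
       \<and> (WSC f \<longleftrightarrow>
            (\<exists>c. c \<noteq> 0 \<and> (\<forall>y\<in>value_set f. of_nat (e f y) * poly (pderiv (phi f)) y = c)))"
proof -
  \<comment> \<open>Under WSC, \<open>C f\<close> is the power sum at
    \<open>card (value_set f) - 1\<close>, the first nonzero one. Conversely, (b) yields (c) with
    the constant \<open>C f\<close>.\<close>
  have "weakly_WSC f" "C f \<noteq> 0" if "WSC f"
    using that WSC_iff[of f] by (auto simp: weakly_WSC_def WSC_def C_def)
  then show ?thesis
    using WSC_imp_mult_pderiv_eq_C[of f] WSC_if_mult_pderiv_const[of _ f] by blast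
qed

end
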